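(* Every deterministic memoryless algorithm that is not one-directional can be forced to a competitive ratio of at least $2$ for online unweighted single-lengthed interval selection with revocable decisions under random order arrivals: for such an algorithm there are instances in which all intervals have the same length on which, with high probability (probability tending to $1$ as the number of duplicate copies of an interval in the instance grows), $\mathrm{OPT}/\mathrm{ALG}\ge 2$.
   Context: Intervals are half-open $[s,f)$, all of the same length $L$; two intervals conflict if they intersect. The adversary chooses the (multi)set of intervals, which then arrive in uniformly random order. The algorithm maintains a set of pairwise non-conflicting intervals, may take a new interval while discarding conflicting current ones, and discarded or rejected intervals cannot be taken again. A deterministic memoryless algorithm decides on each arriving interval using only that interval and its current solution. When the current solution is a single interval $I_{old}=[s_{old},f_{old})$ and the new interval $I_{new}=[s_{new},f_{new})$ partially overlaps it, the conflict is on the left of $I_{old}$ if $s_{new}<s_{old}<f_{new}$ (overlap $v=f_{new}-s_{old}$) and on the right if $s_{new}<f_{old}<f_{new}$ (overlap $v=f_{old}-s_{new}$); the algorithm's behavior is described by $F_l,F_r:(0,L)\to\{0,1\}$, where $F_l(v)$ (resp. $F_r(v)$) indicates whether it replaces $I_{old}$ by $I_{new}$ for a left (resp. right) conflict with overlap $v$. The algorithm is one-directional if it replaces only in one direction regardless of the overlap amount, i.e., either $F_l\equiv1$ and $F_r\equiv0$, or $F_l\equiv0$ and $F_r\equiv1$. $\mathrm{OPT}$ is the maximum number of pairwise disjoint intervals in the instance and $\mathrm{ALG}$ the number of intervals in the algorithm's final solution. *)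

theory Defs
  imports "HOL-Probability.Probability" "HOL-Combinatorics.Multiset_Permutations"
begin

text \<open>The pair \<open>(s, f)\<close> stands for the half-open interval \<open>[s, f)\<close>.\<close>

type_synonym interval = "real \<times> real"

definition points :: "interval \<Rightarrow> real set" where
  "points I = {fst I..<snd I}"

definition has_length :: "real \<Rightarrow> interval \<Rightarrow> bool" where
  "has_length L I \<longleftrightarrow> snd I - fst I = L"

definition conflict :: "interval \<Rightarrow> interval \<Rightarrow> bool" where
  "conflict I J \<longleftrightarrow> points I \<inter> points J \<noteq> {}"

text \<open>
  A deterministic memoryless algorithm is its acceptance rule: \<open>A S I\<close> says whether the arriving
  interval \<open>I\<close> is taken when the current solution is \<open>S\<close>. No restriction is imposed on the rule; in
  particular it may reject an interval that conflicts with nothing.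

  Solutions can be sets although instances are multisets: copies of a nonempty interval conflict
  with each other, so no solution contains two of them.
\<close>

type_synonym algorithm = "interval set \<Rightarrow> interval \<Rightarrow> bool"

definition step :: "algorithm \<Rightarrow> interval set \<Rightarrow> interval \<Rightarrow> interval set" where
  "step A S I = (if A S I then insert I {J \<in> S. \<not> conflict I J} else S)"

definition final_solution :: "algorithm \<Rightarrow> interval list \<Rightarrow> interval set" where
  "final_solution A xs = foldl (step A) {} xs"

definition ALG :: "algorithm \<Rightarrow> interval list \<Rightarrow> nat" where
  "ALG A xs = card (final_solution A xs)"

definition OPT :: "interval multiset \<Rightarrow> nat" where
  "OPT M = Max (card ` {S. S \<subseteq> set_mset M \<and> disjoint_family_on points S})"

text \<open>
  Every arrangement of a multiset arises from the same number of orderings of its labelled copies,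
  so a uniformly random order of the copies induces the uniform distribution on arrangements.
\<close>

definition random_order :: "interval multiset \<Rightarrow> interval list pmf" where
  "random_order M = pmf_of_set (permutations_of_multiset M)"

text \<open>
  The quotient is taken in \<^typ>\<open>ennreal\<close>, so that it is \<open>\<infinity>\<close> (and not \<open>0\<close>) when the algorithm ends
  with no interval on a nonempty instance.
\<close>

definition ratio :: "algorithm \<Rightarrow> interval multiset \<Rightarrow> interval list \<Rightarrow> ennreal" where
  "ratio A M xs = of_nat (OPT M) / of_nat (ALG A xs)"

definition left_conflict :: "interval \<Rightarrow> interval \<Rightarrow> bool" where
  "left_conflict I_old I_new \<longleftrightarrow> fst I_new < fst I_old \<and> fst I_old < snd I_new"

definition right_conflict :: "interval \<Rightarrow> interval \<Rightarrow> bool" where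
  "right_conflict I_old I_new \<longleftrightarrow> fst I_new < snd I_old \<and> snd I_old < snd I_new"

text \<open>
  For intervals of length \<open>L\<close> the overlaps below lie in \<open>(0, L)\<close>, so only the values of
  \<open>F\<^sub>l\<close> and \<open>F\<^sub>r\<close> there matter. Nothing is said about current solutions with two or more intervals.
\<close>

definition described_by ::
    "real \<Rightarrow> algorithm \<Rightarrow> (real \<Rightarrow> bool) \<Rightarrow> (real \<Rightarrow> bool) \<Rightarrow> bool" where
  "described_by L A F\<^sub>l F\<^sub>r \<longleftrightarrow>
     (\<forall>I_old I_new. has_length L I_old \<longrightarrow> has_length L I_new \<longrightarrow>
        (left_conflict I_old I_new \<longrightarrow> A {I_old} I_new = F\<^sub>l (snd I_new - fst I_old)) \<and>
        (right_conflict I_old I_new \<longrightarrow> A {I_old} I_new = F\<^sub>r (snd I_old - fst I_new)))"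

definition one_directional :: "real \<Rightarrow> (real \<Rightarrow> bool) \<Rightarrow> (real \<Rightarrow> bool) \<Rightarrow> bool" where
  "one_directional L F\<^sub>l F\<^sub>r \<longleftrightarrow>
     (\<forall>v\<in>{0<..<L}. F\<^sub>l v \<and> \<not> F\<^sub>r v) \<or> (\<forall>v\<in>{0<..<L}. \<not> F\<^sub>l v \<and> F\<^sub>r v)"

end

theory Submission
  imports Defs "HOL-Real_Asymp.Real_Asymp"
begin

text \<open>
  Write \<open>R d\<close> for \<open>F\<^sub>r (L - d)\<close> and \<open>T d\<close> for \<open>F\<^sub>l (L - d)\<close>, the decisions on an interval shifted by
  \<open>d\<close> to the right and to the left. Flood the instance with copies of \<open>I = [0, L)\<close> and add \<open>I + d\<close>
  and \<open>I - e\<close>, with \<open>d + e \<ge> L\<close> so that \<open>OPT \<ge> 2\<close>. With high probability a copy of \<open>I\<close> comes first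
  and another one comes between the two extra intervals. If \<open>R d \<longrightarrow> T d\<close> and \<open>T e \<longrightarrow> R e\<close>, then
  whenever the algorithm leaves \<open>I\<close> for one of the extra intervals, the next copy of \<open>I\<close> brings it
  back, so it always holds a single interval. (If the algorithm rejects \<open>I\<close> when it
  holds nothing, copies of \<open>I\<close> alone make it end with no interval.)

  Such \<open>d\<close> and \<open>e\<close> exist: since the algorithm is not one-directional, some \<open>d\<^sub>0\<close> satisfies the first
  implication and some \<open>e\<^sub>0\<close> the second. Any \<open>m\<close> satisfies at least one of them, so taking \<open>m\<close> close
  to \<open>L\<close>, one of the pairs \<open>(d\<^sub>0, m)\<close> and \<open>(m, e\<^sub>0)\<close> will do.
\<close>

text \<open>The favourable arrangements: \<open>Suc\<close> forces a copy of \<open>z\<close> before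
  \<open>u\<close> and another between \<open>u\<close> and \<open>v\<close>, none after
  \<open>v\<close>. For \<open>a + b \<le> k\<close> there are \<open>k + 2\<close> copies in
  all.\<close>

definition spread :: "'a \<Rightarrow> nat \<Rightarrow> 'a \<Rightarrow> 'a \<Rightarrow> nat \<times> nat \<Rightarrow> 'a list" where
  "spread z k u v = (\<lambda>(a, b).
     replicate (Suc a) z @ u # replicate (Suc b) z @ v # replicate (k - a - b) z)"

lemma replicate_append_eq_iff:
  assumes "u \<noteq> z" "u' \<noteq> z"
  shows "replicate a z @ u # xs = replicate b z @ u' # ys \<longleftrightarrow> a = b \<and> u = u' \<and> xs = ys"
proof (induction a arbitrary: b)
  case 0
  then show ?case using assms by (cases b) auto
next
  case (Suc a)
  then show ?case using assms by (cases b) auto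
qed

text \<open>Serves both for injectivity in the block lengths and for separating the two orders of
  the extra elements.\<close>

lemma spread_eq_iff:
  assumes "u \<noteq> z" "v \<noteq> z" "u' \<noteq> z" "v' \<noteq> z"
  shows "spread z k u v p = spread z k u' v' q \<longleftrightarrow> p = q \<and> u = u' \<and> v = v'"
  using assms unfolding spread_def
  by (cases p; cases q) (auto simp: replicate_append_eq_iff simp del: replicate_Suc)

lemma mset_spread:
  assumes "a + b \<le> k"
  shows "mset (spread z k u v (a, b)) = {#u, v#} + replicate_mset (k + 2) z"
proof -
  obtain c where "k = a + b + c" using assms le_Suc_ex by blast
  then show ?thesis
    by (intro multiset_eqI) (simp add: spread_def del: replicate_Suc)
qed

lemma card_nat_pairs_sum_le:
  "2 * card (SIGMA a:{..k}. {..k - a}) = (k + 1) * (k + 2)" for k :: nat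
proof -
  have "card (SIGMA a:{..k}. {..k - a}) = (\<Sum>a\<le>k. Suc (k - a))"
    by simp
  also have "\<dots> = (\<Sum>a\<le>k. Suc a)"
    by (rule sum.reindex_bij_witness[of _ "\<lambda>a. k - a" "\<lambda>a. k - a"]) auto
  also have "2 * \<dots> = (k + 1) * (k + 2)"
    by (induction k) auto
  finally show ?thesis .
qed

lemma card_permutations_two_extra:
  assumes "x \<noteq> y" "x \<noteq> z" "y \<noteq> z"
  shows "card (permutations_of_multiset ({#x, y#} + replicate_mset k z)) = (k + 1) * (k + 2)"
proof -
  let ?M = "{#x, y#} + replicate_mset k z"
  \<comment> \<open>For \<open>k = 0\<close> the element \<open>z\<close> is not in the support; its
    factor is then \<open>fact 0 = 1\<close>.\<close>
  have "(\<Prod>w\<in>set_mset ?M. fact (count ?M w)) = (\<Prod>w\<in>{x, y, z}. fact (count ?M w) :: nat)"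
    by (rule prod.mono_neutral_left) (auto simp: not_in_iff)
  also have "\<dots> = fact k"
    using assms by auto
  finally have "card (permutations_of_multiset ?M) = fact (k + 2) div fact k"
    by (simp add: card_permutations_of_multiset)
  also have "fact (k + 2) = ((k + 1) * (k + 2)) * fact k"
    by (simp add: algebra_simps)
  also have "\<dots> div fact k = (k + 1) * (k + 2)"
    by (rule nonzero_mult_div_cancel_right) simp
  finally show ?thesis .
qed

text \<open>Each order of \<open>x\<close> and \<open>y\<close> contributes
  \<open>(k + 1) * (k + 2) / 2\<close> favourable arrangements, out of
  \<open>(k + 3) * (k + 4)\<close> in total, and the quotient tends to 1.\<close>

lemma prob_spread_tendsto_1:
  assumes neq: "x \<noteq> y" "x \<noteq> z" "y \<noteq> z"
    and good: "\<And>k p. P k (spread z k x y p)" "\<And>k p. P k (spread z k y x p)"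
  shows "(\<lambda>k. measure_pmf.prob
           (pmf_of_set (permutations_of_multiset ({#x, y#} + replicate_mset (k + 2) z)))
           {xs. P k xs}) \<longlonglongrightarrow> 1"
proof -
  define S where "S k = permutations_of_multiset ({#x, y#} + replicate_mset (k + 2) z)" for k
  let ?D = "\<lambda>k::nat. SIGMA a:{..k}. {..k - a}"
  have "(\<lambda>k. measure_pmf.prob (pmf_of_set (S k)) {xs. P k xs}) \<longlonglongrightarrow> 1"
  proof (rule tendsto_sandwich)
    show "\<forall>\<^sub>F k in sequentially. real ((k + 1) * (k + 2)) / real ((k + 2 + 1) * (k + 2 + 2))
            \<le> measure_pmf.prob (pmf_of_set (S k)) {xs. P k xs}"
    proof (rule always_eventually, rule allI)
      fix k
      have mem: "spread z k x y p \<in> S k" "spread z k y x p \<in> S k" if p: "p \<in> ?D k" for p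
      proof -
        obtain a b where "p = (a, b)" "a + b \<le> k" using p by (cases p) auto
        then show "spread z k x y p \<in> S k" "spread z k y x p \<in> S k"
          unfolding S_def
          by (auto intro!: permutations_of_multisetI simp only: mset_spread add_mset_commute)
      qed
      have "(k + 1) * (k + 2) = card (spread z k x y ` ?D k \<union> spread z k y x ` ?D k)"
      proof (subst card_Un_disjoint)
        show "spread z k x y ` ?D k \<inter> spread z k y x ` ?D k = {}"
          using neq by (auto simp: spread_eq_iff)
        have "inj_on (spread z k x y) (?D k)" "inj_on (spread z k y x) (?D k)"
          using neq by (auto intro!: inj_onI simp: spread_eq_iff)
        then show "(k + 1) * (k + 2) = card (spread z k x y ` ?D k) + card (spread z k y x ` ?D k)"
          using card_nat_pairs_sum_le[of k] by (simp only: card_image)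
      qed auto
      also have "\<dots> \<le> card (S k \<inter> {xs. P k xs})"
      proof (rule card_mono)
        show "spread z k x y ` ?D k \<union> spread z k y x ` ?D k \<subseteq> S k \<inter> {xs. P k xs}"
          using mem good by blast
      qed (simp add: S_def)
      finally have le: "(k + 1) * (k + 2) \<le> card (S k \<inter> {xs. P k xs})" .
      have card: "card (S k) = (k + 2 + 1) * (k + 2 + 2)"
        unfolding S_def by (rule card_permutations_two_extra[OF neq])
      have "measure_pmf.prob (pmf_of_set (S k)) {xs. P k xs}
          = real (card (S k \<inter> {xs. P k xs})) / real (card (S k))"
        by (rule measure_pmf_of_set) (simp_all only: S_def permutations_of_multiset_not_empty
          finite_permutations_of_multiset not_False_eq_True)
      then show "real ((k + 1) * (k + 2)) / real ((k + 2 + 1) * (k + 2 + 2))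
            \<le> measure_pmf.prob (pmf_of_set (S k)) {xs. P k xs}"
        by (simp only: card) (intro divide_right_mono of_nat_mono le of_nat_0_le_iff)
    qed
    show "(\<lambda>k. real ((k + 1) * (k + 2)) / real ((k + 2 + 1) * (k + 2 + 2))) \<longlonglongrightarrow> 1"
      by simp real_asymp
    show "\<forall>\<^sub>F k in sequentially.
            measure_pmf.prob (pmf_of_set (S k)) {xs. P k xs} \<le> 1"
      by (rule always_eventually) simp
  qed (rule tendsto_const)
  then show ?thesis unfolding S_def .
qed

text \<open>Taking a copy discards the old one, which conflicts with it as \<open>L > 0\<close>;
  rejecting it changes nothing.\<close>

lemma step_same: "has_length L I \<Longrightarrow> L > 0 \<Longrightarrow> step A {I} I = {I}"
  by (auto simp: step_def conflict_def points_def has_length_def)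

lemma foldl_step_replicate:
  assumes "has_length L I" "L > 0" "step A S I = {I}"
  shows "foldl (step A) S (replicate (Suc n) I) = {I}"
proof -
  have "foldl (step A) {I} (replicate n I) = {I}"
    by (induction n) (use step_same[OF assms(1,2)] in auto)
  then show ?thesis using assms by simp
qed

lemma card_final_solution_spread:
  assumes I: "has_length L I" "L > 0" "A {} I"
    and returns: "\<And>w. w \<in> {u, v} \<Longrightarrow>
      \<exists>J. step A {I} w = {J} \<and> step A {J} I = {I}"
  shows "card (final_solution A (spread I k u v p)) = 1"
proof -
  obtain a b where p: "p = (a, b)" by (cases p)
  obtain J K where J: "step A {I} u = {J}" "step A {J} I = {I}"
    and K: "step A {I} v = {K}" "step A {K} I = {I}"
    using returns[of u] returns[of v] by auto
  have "step A {} I = {I}" using I by (simp add: step_def)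
  then have "final_solution A (spread I k u v p) = foldl (step A) {K} (replicate (k - a - b) I)"
    by (simp add: final_solution_def spread_def p J K foldl_step_replicate[OF I(1,2)]
        del: replicate_Suc)
  also have "card \<dots> = 1"
  \<comment> \<open>If the last block is empty the solution stays \<open>{K}\<close>; otherwise it
    returns to \<open>{I}\<close>.\<close>
  proof (cases "k - a - b")
    case (Suc n)
    show ?thesis unfolding Suc foldl_step_replicate[OF I(1,2) K(2)] by simp
  qed simp
  finally show ?thesis .
qed

lemma OPT_ge_card:
  assumes "S \<subseteq> set_mset M" "disjoint_family_on points S"
  shows "card S \<le> OPT M"
  unfolding OPT_def by (rule Max_ge) (use assms in auto)

lemma exists_returning_shifts:
  fixes L :: real
  assumes "L > 0" "\<not> one_directional L F\<^sub>l F\<^sub>r"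
  obtains d e where "0 < d" "d < L" "0 < e" "e < L" "d + e \<ge> L"
    "F\<^sub>r (L - d) \<Longrightarrow> F\<^sub>l (L - d)" "F\<^sub>l (L - e) \<Longrightarrow> F\<^sub>r (L - e)"
proof -
  \<comment> \<open>\<open>w\<close> refutes the first disjunct of \<open>one_directional\<close>
    and \<open>v\<close> the second.\<close>
  obtain v w where v: "0 < v" "v < L" "F\<^sub>r v \<longrightarrow> F\<^sub>l v" and w: "0 < w" "w < L" "F\<^sub>l w \<longrightarrow> F\<^sub>r w"
    using assms(2) unfolding one_directional_def by auto
  \<comment> \<open>Here \<open>m\<close> is an overlap, with shift \<open>L - m\<close>. The bound
    \<open>m \<le> L - v\<close> gives \<open>(L - v) + (L - m) \<ge> L\<close>, and likewise for
    \<open>w\<close>.\<close>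
  define m where "m = min (L - v) (L - w)"
  have m: "0 < m" "m < L" "m \<le> L - v" "m \<le> L - w" using v w by (auto simp: m_def)
  show thesis
  proof (cases "F\<^sub>l m \<longrightarrow> F\<^sub>r m")
    case True
    then show thesis using v m by (intro that[of "L - v" "L - m"]) auto
  next
    case False
    then show thesis using w m by (intro that[of "L - m" "L - w"]) auto
  qed
qed

lemma step_conflict:
  "conflict I J \<Longrightarrow> step A {J} I = (if A {J} I then {I} else {J})"
  by (auto simp: step_def)

text \<open>If \<open>J\<close> is rejected, \<open>I\<close> is still held; if it is taken, the
  last hypothesis lets \<open>I\<close> replace it again.\<close>

lemma conflict_returns:
  assumes "has_length L I" "L > 0" "conflict I J" "A {I} J \<Longrightarrow> A {J} I"
  shows "\<exists>K. step A {I} J = {K} \<and> step A {K} I = {I}"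
proof -
  have c: "conflict J I" using assms(3) by (auto simp: conflict_def)
  show ?thesis
  proof (cases "A {I} J")
    case True
    then show ?thesis
      using step_conflict[OF c, of A] step_conflict[OF assms(3), of A] assms(4) by simp
  next
    case False
    then show ?thesis
      using step_conflict[OF c, of A] step_same[OF assms(1,2), of A] by simp
  qed
qed

lemma ratio_rejected_copies:
  assumes "\<not> A {} I" "k > 0" "xs \<in> permutations_of_multiset (replicate_mset k I)"
  shows "ratio A (replicate_mset k I) xs \<ge> 2"
proof -
  have "set_mset (mset xs) \<subseteq> {I}"
    using permutations_of_multisetD[OF assms(3)] by simp
  then have "set xs \<subseteq> {I}" by simp
  then have "foldl (step A) {} xs = {}"
    by (induction xs) (use assms(1) in \<open>auto simp: step_def\<close>)
  then have "ALG A xs = 0" by (simp add: ALG_def final_solution_def)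
  moreover have "OPT (replicate_mset k I) \<ge> 1"
    using OPT_ge_card[of "{I}" "replicate_mset k I"] assms(2)
    by (simp add: disjoint_family_on_def)
  ultimately show ?thesis by (simp add: ratio_def ennreal_divide_zero)
qed

lemma ratio_ge_2:
  assumes "ALG A xs = 1" "2 \<le> OPT M"
  shows "ratio A M xs \<ge> 2"
proof -
  have "(of_nat 2 :: ennreal) \<le> of_nat (OPT M)"
    by (rule of_nat_mono) (rule assms)
  then show ?thesis by (simp add: ratio_def assms(1) divide_ennreal_def)
qed

theorem theorem5:
  fixes L :: real and A :: algorithm and F\<^sub>l F\<^sub>r :: "real \<Rightarrow> bool"
  assumes "L > 0"
    and "described_by L A F\<^sub>l F\<^sub>r"
    and "\<not> one_directional L F\<^sub>l F\<^sub>r"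
  shows "\<exists>(M :: interval multiset) (I :: interval).
           (\<forall>J \<in># add_mset I M. has_length L J) \<and>
           (\<lambda>k. measure_pmf.prob (random_order (M + replicate_mset k I))
                  {xs. ratio A (M + replicate_mset k I) xs \<ge> 2}) \<longlonglongrightarrow> 1"
proof -
  define I :: interval where "I = (0, L)"
  have I: "has_length L I" by (simp add: I_def has_length_def)
  show ?thesis
  proof (cases "A {} I")
    case False
    have "measure_pmf.prob (random_order (replicate_mset k I))
            {xs. ratio A (replicate_mset k I) xs \<ge> 2} = 1" if "k > 0" for k
      using ratio_rejected_copies[of A I k, OF False that]
      by (subst measure_pmf.prob_eq_1)
         (auto simp: AE_measure_pmf_iff random_order_def permutations_of_multiset_not_empty)
    then have "(\<lambda>k. measure_pmf.prob (random_order ({#} + replicate_mset k I))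
            {xs. ratio A ({#} + replicate_mset k I) xs \<ge> 2}) \<longlonglongrightarrow> 1"
      \<comment> \<open>The empty instance \<open>k = 0\<close> is left out, since its
        \<open>OPT\<close> is 0.\<close>
      by (intro tendsto_eventually eventually_sequentiallyI[of 1]) simp
    with I show ?thesis by (intro exI[of _ "{#}"] exI[of _ I]) simp
  next
    case True
    obtain d e where de: "0 < d" "d < L" "0 < e" "e < L" "d + e \<ge> L"
      and d: "F\<^sub>r (L - d) \<Longrightarrow> F\<^sub>l (L - d)" and e: "F\<^sub>l (L - e) \<Longrightarrow> F\<^sub>r (L - e)"
      using exists_returning_shifts[OF assms(1,3)] by blast
    define X Y :: interval where "X = (d, d + L)" and "Y = (- e, L - e)"
    have XY: "has_length L X" "has_length L Y" by (simp_all add: X_def Y_def has_length_def)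
    have neq: "X \<noteq> Y" "X \<noteq> I" "Y \<noteq> I" using de by (auto simp: X_def Y_def I_def)
    have conflicts: "conflict I X" "conflict I Y"
      using de by (auto simp: conflict_def points_def X_def Y_def I_def)
    have decisions:
      "left_conflict J K \<Longrightarrow> A {J} K = F\<^sub>l (snd K - fst J)"
      "right_conflict J K \<Longrightarrow> A {J} K = F\<^sub>r (snd J - fst K)"
      if "has_length L J" "has_length L K" for J K
      using assms(2) that unfolding described_by_def by blast+
    \<comment> \<open>Exchanging the old and the new interval swaps left and right but keeps the
      overlap.\<close>
    have "A {I} X = F\<^sub>r (L - d)" "A {X} I = F\<^sub>l (L - d)"
      "A {I} Y = F\<^sub>l (L - e)" "A {Y} I = F\<^sub>r (L - e)"
      using decisions(2)[OF I XY(1)] decisions(1)[OF XY(1) I]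
        decisions(1)[OF I XY(2)] decisions(2)[OF XY(2) I] de
      by (simp_all add: right_conflict_def left_conflict_def X_def Y_def I_def)
    then have "A {I} X \<Longrightarrow> A {X} I" "A {I} Y \<Longrightarrow> A {Y} I"
      using d e by simp_all
    then have returns: "\<exists>J. step A {I} w = {J} \<and> step A {J} I = {I}" if "w \<in> {X, Y}" for w
      using that conflict_returns[OF I \<open>L > 0\<close> conflicts(1)]
        conflict_returns[OF I \<open>L > 0\<close> conflicts(2)] by blast
    have good: "ratio A ({#X, Y#} + replicate_mset (k + 2) I) (spread I k u v p) \<ge> 2"
      if "{u, v} = {X, Y}" for u v p k
    proof -
      have "ALG A (spread I k u v p) = 1"
        unfolding ALG_def
        by (rule card_final_solution_spread[where A = A, OF I \<open>L > 0\<close> True],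
            rule returns, simp only: that)
      \<comment> \<open>\<open>Y\<close> ends at \<open>L - e \<le> d\<close>, where
        \<open>X\<close> starts; half-open intervals may touch.\<close>
      moreover have "disjoint_family_on points {X, Y}"
        using de by (auto simp: disjoint_family_on_def points_def X_def Y_def)
      then have "card {X, Y} \<le> OPT ({#X, Y#} + replicate_mset (k + 2) I)"
        by (intro OPT_ge_card) auto
      then have "2 \<le> OPT ({#X, Y#} + replicate_mset (k + 2) I)"
        using neq by simp
      ultimately show ?thesis by (rule ratio_ge_2)
    qed
    have "(\<lambda>k. measure_pmf.prob (random_order ({#X, Y#} + replicate_mset (k + 2) I))
            {xs. ratio A ({#X, Y#} + replicate_mset (k + 2) I) xs \<ge> 2}) \<longlonglongrightarrow> 1"
      unfolding random_order_def
      by (rule prob_spread_tendsto_1[OF neq]; rule good; blast)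
    then have "(\<lambda>k. measure_pmf.prob (random_order ({#X, Y#} + replicate_mset k I))
            {xs. ratio A ({#X, Y#} + replicate_mset k I) xs \<ge> 2}) \<longlonglongrightarrow> 1"
      by (rule LIMSEQ_offset)
    with I XY show ?thesis by (intro exI[of _ "{#X, Y#}"] exI[of _ I]) simp
  qed
qed

end
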